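(* Let $d\ge 2$ be fixed and let $(X_{i1},\ldots,X_{id})$, $i=1,2,\ldots$, be i.i.d. random vectors in $\mathbb{R}^d$ with joint cumulative distribution function $F$ having absolutely continuous univariate marginal distribution functions $F_1,\ldots,F_d$, and let $C$ be the unique copula of $F$, i.e. $F(x_1,\ldots,x_d)=C(F_1(x_1),\ldots,F_d(x_d))$ for all $(x_1,\ldots,x_d)\in\mathbb{R}^d$. For each $n$ and each $m=(m_1,\ldots,m_d)$ of positive integers, let $C^{\#}_{m,n}$ be the empirical checkerboard Bernstein copula (defined in the context) built from the first $n$ observations. For each $n$, let the degrees be random with the prior distribution $$m_j\mid \alpha_j \overset{\text{ind}}{\sim} \mathrm{Poisson}(n^{\alpha_j})+1,\qquad \alpha_j\overset{\text{i.i.d.}}{\sim}\mathrm{Unif}\left(\tfrac13,\tfrac23\right),\qquad j\in\{1,\ldots,d\}.$$ Then $$E\left(\|C^{\#}_{m,n}-C\|\right)=E\left[\sup_{\mathbf{u}\in[0,1]^d}\left|C^{\#}_{m,n}(\mathbf{u})-C(\mathbf{u})\right|\right]\longrightarrow 0\quad\text{almost surely as } n\to\infty,$$ where the expectation $E$ is taken with respect to the prior distribution of $(m_1,\ldots,m_d)$ (with the data held fixed), and "almost surely" refers to the law of the data sequence.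
   Context: For a sample of size $n$, let $R^{(n)}_{i,j}$ denote the rank of $X_{ij}$ among $X_{1j},\ldots,X_{nj}$ (ties have probability zero because the marginals are continuous). The empirical checkerboard copula is $$C^{\#}_n(\mathbf{u})=\frac1n\sum_{i=1}^n\prod_{j=1}^d\min\left(\max\left(nu_j-R^{(n)}_{i,j}+1,\,0\right),\,1\right),\qquad \mathbf{u}=(u_1,\ldots,u_d)\in[0,1]^d.$$ For positive integers $m_1,\ldots,m_d$, the empirical checkerboard Bernstein copula (ECBC) with degrees $m=(m_1,\ldots,m_d)$ is $$C^{\#}_{m,n}(\mathbf{u})=\sum_{k_1=0}^{m_1}\cdots\sum_{k_d=0}^{m_d} C^{\#}_n\left(\frac{k_1}{m_1},\ldots,\frac{k_d}{m_d}\right)\prod_{j=1}^d\binom{m_j}{k_j}u_j^{k_j}(1-u_j)^{m_j-k_j}.$$ For a function $g$ on $[0,1]^d$, $\|g\|=\sup_{\mathbf{u}\in[0,1]^d}|g(\mathbf{u})|$. A $d$-dimensional copula is the joint distribution function on $[0,1]^d$ of a random vector whose marginals are all uniform on $[0,1]$. The notation $m_j\sim\mathrm{Poisson}(\lambda)+1$ means that $m_j-1$ has the Poisson distribution with mean $\lambda$. The pairs $(\alpha_j,m_j)$, $j\in\{1,\ldots,d\}$, are independent, and the prior does not depend on the data other than through the sample size $n$. *)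

theory Defs
  imports "HOL-Probability.Probability"
begin

definition joint_cdf :: "(real ^ 'd) measure \<Rightarrow> real ^ 'd \<Rightarrow> real" where
  "joint_cdf \<mu> x = measure \<mu> {y. \<forall>j. y $ j \<le> x $ j}"

(* The library's absolutely_continuous relates two measures; this is the classical epsilon-delta
   notion for a function on the real line.  A pair (a, b) in I stands for the interval ]a, b[. *)
definition absolutely_continuous_function :: "(real \<Rightarrow> real) \<Rightarrow> bool" where
  "absolutely_continuous_function f \<longleftrightarrow>
    (\<forall>\<epsilon>>0. \<exists>\<delta>>0. \<forall>I :: (real \<times> real) set.
       finite I \<and> (\<forall>(a, b)\<in>I. a \<le> b) \<and> disjoint_family_on (\<lambda>(a, b). {a<..<b}) I \<and>
       (\<Sum>(a, b)\<in>I. b - a) < \<delta> \<longrightarrow> (\<Sum>(a, b)\<in>I. \<bar>f b - f a\<bar>) < \<epsilon>)"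

abbreviation unit_cube :: "(real ^ 'd) set" where
  "unit_cube \<equiv> {u. \<forall>j. 0 \<le> u $ j \<and> u $ j \<le> 1}"

(* Only the values on the unit cube are constrained; \<mu> is the law of a random vector with
   uniform margins. *)
definition is_copula :: "(real ^ 'd \<Rightarrow> real) \<Rightarrow> bool" where
  "is_copula C \<longleftrightarrow>
    (\<exists>\<mu> :: (real ^ 'd) measure. prob_space \<mu> \<and> sets \<mu> = sets borel \<and>
       (\<forall>j. distr \<mu> borel (\<lambda>y. y $ j) = uniform_measure lborel {0..1}) \<and>
       (\<forall>u\<in>unit_cube. C u = joint_cdf \<mu> u))"

definition sup_norm :: "(real ^ 'd \<Rightarrow> real) \<Rightarrow> real" where
  "sup_norm g = (SUP u\<in>unit_cube. \<bar>g u\<bar>)"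

(* Observations are indexed from 0, so a sample x of size n consists of x 0, ..., x (n - 1);
   ranks take the values 1, ..., n. *)
definition sample_rank :: "(nat \<Rightarrow> real ^ 'd) \<Rightarrow> nat \<Rightarrow> nat \<Rightarrow> 'd \<Rightarrow> nat" where
  "sample_rank x n i j = card {l. l < n \<and> x l $ j \<le> x i $ j}"

definition checkerboard_copula :: "(nat \<Rightarrow> real ^ 'd) \<Rightarrow> nat \<Rightarrow> real ^ 'd \<Rightarrow> real" where
  "checkerboard_copula x n u =
    1 / real n * (\<Sum>i<n. \<Prod>j\<in>UNIV.
      min (max (real n * u $ j - real (sample_rank x n i j) + 1) 0) 1)"

definition ecbc :: "(nat \<Rightarrow> real ^ 'd) \<Rightarrow> nat \<Rightarrow> ('d \<Rightarrow> nat) \<Rightarrow> real ^ 'd \<Rightarrow> real" where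
  "ecbc x n m u =
    (\<Sum>k\<in>(\<Pi>\<^sub>E j\<in>UNIV. {0..m j}).
      checkerboard_copula x n (\<chi> j. real (k j) / real (m j)) *
      (\<Prod>j\<in>UNIV. real (m j choose k j) * (u $ j) ^ k j * (1 - u $ j) ^ (m j - k j)))"

(* Joint law of a pair (\<alpha>, m): \<alpha> is uniform on ]1/3, 2/3[ and, given \<alpha> = a, m - 1 is Poisson
   with mean n^a. *)
definition pair_prior :: "nat \<Rightarrow> (real \<times> nat) measure" where
  "pair_prior n =
    uniform_measure lborel {1/3<..<2/3} \<bind>
      (\<lambda>a. distr (measure_pmf (poisson_pmf (real n powr a)))
              (borel \<Otimes>\<^sub>M count_space UNIV) (\<lambda>k. (a, k + 1)))"

definition degree_prior :: "nat \<Rightarrow> ('d::finite \<Rightarrow> nat) measure" where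
  "degree_prior n =
    distr (\<Pi>\<^sub>M j\<in>UNIV. pair_prior n) (\<Pi>\<^sub>M j\<in>UNIV. count_space UNIV) (\<lambda>w j. snd (w j))"

end

theory Submission
  imports Defs "HOL-Real_Asymp.Real_Asymp"
begin

text \<open>
  The vector of probability integral transforms \<open>U = (F\<^sub>1(X\<^sub>1), \<dots>, F\<^sub>d(X\<^sub>d))\<close> has uniform margins and joint
  distribution function \<open>C\<close>. Hoeffding's inequality and the Borel--Cantelli lemma give almost sure
  convergence of the empirical distribution function of \<open>U\<close> at all rational points. Since the
  transforms are monotone, comparing ranks with frequencies of \<open>U\<close> sandwiches the empirical
  checkerboard copula between this empirical distribution function at neighbouring points of a grid;
  monotonicity and the Lipschitz property of copulas make the convergence uniform on the cube, ties
  playing no role.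

  Bernstein weights are nonnegative and sum to one, so smoothing does not increase the sup-distance
  to \<open>C\<close> except for the bias of the Bernstein polynomial of \<open>C\<close>, which by the Lipschitz property is at
  most \<open>\<Sum>\<^sub>j E\<bar>K\<^sub>j / m\<^sub>j - u\<^sub>j\<bar> \<le> \<Sum>\<^sub>j (t / 2 + 1 / (8 t m\<^sub>j))\<close> for binomial \<open>K\<^sub>j\<close> and every \<open>t > 0\<close>.
  Finally \<open>E[1 / m\<^sub>j] \<le> n\<^sup>-\<^sup>1\<^sup>/\<^sup>3\<close> under the prior, because \<open>E[1 / (K + 1)] \<le> 1 / \<lambda>\<close> for a Poisson variable
  \<open>K\<close> with mean \<open>\<lambda>\<close>.
\<close>

subsection \<open>Bernstein smoothing\<close>

text \<open>Distributing the product of sums separates the coordinates: with \<open>h\<close>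
  inserted only into factor \<open>i\<close>, every other factor contributes its total weight 1.
  This is the passage from product weights to their margin in coordinate \<open>i\<close>.\<close>

lemma sum_PiE_marginal:
  fixes w :: "'d::finite \<Rightarrow> nat \<Rightarrow> real"
  assumes "\<And>j. (\<Sum>k\<le>m j. w j k) = 1"
  shows "(\<Sum>k\<in>(\<Pi>\<^sub>E j\<in>UNIV. {0..m j}). h (k i) * (\<Prod>j\<in>UNIV. w j (k j))) =
    (\<Sum>k\<le>m i. h k * w i k)"
proof -
  have "(\<Sum>k\<in>(\<Pi>\<^sub>E j\<in>UNIV. {0..m j}). h (k i) * (\<Prod>j\<in>UNIV. w j (k j))) =
     (\<Sum>k\<in>(\<Pi>\<^sub>E j\<in>UNIV. {0..m j}). \<Prod>j\<in>UNIV. (if j = i then h (k j) else 1) * w j (k j))"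
    by (intro sum.cong refl) (simp add: prod.distrib)
  also have "\<dots> = (\<Prod>j\<in>UNIV. \<Sum>k\<in>{0..m j}. (if j = i then h k else 1) * w j k)"
    by (rule prod_sum_PiE[symmetric]) auto
  also have "\<dots> = (\<Prod>j\<in>UNIV. if j = i then (\<Sum>k\<le>m i. h k * w i k) else 1)"
    using assms by (intro prod.cong refl) (auto simp: atMost_atLeast0)
  also have "\<dots> = (\<Sum>k\<le>m i. h k * w i k)"
    by simp
  finally show ?thesis .
qed

text \<open>This is the variance of \<open>K / n\<close> for binomial \<open>K\<close>. The square
  is rewritten in terms of \<open>1\<close>, \<open>k\<close> and \<open>k * (k - 1)\<close>, whose
  Bernstein sums have closed forms.\<close>

lemma Bernstein_variance:
  assumes "0 < n"
  shows "(\<Sum>k\<le>n. (real k / real n - x)\<^sup>2 * Bernstein n k x) = x * (1 - x) / real n"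
proof -
  have "(\<Sum>k\<le>n. (real k / real n - x)\<^sup>2 * Bernstein n k x) =
    (\<Sum>k\<le>n. (1 / (real n)\<^sup>2) * (real k * (real k - 1) * Bernstein n k x)
      + (1 / (real n)\<^sup>2 - 2 * x / real n) * (real k * Bernstein n k x) + x\<^sup>2 * Bernstein n k x)"
    using assms by (intro sum.cong refl) (simp add: power2_eq_square field_simps)
  also have "\<dots> = (1 / (real n)\<^sup>2) * (real n * (real n - 1) * x\<^sup>2)
      + (1 / (real n)\<^sup>2 - 2 * x / real n) * (real n * x) + x\<^sup>2"
    by (simp only: sum.distrib sum_distrib_left[symmetric] sum_Bernstein sum_k_Bernstein
        sum_kk_Bernstein mult_1_right)
  also have "\<dots> = x * (1 - x) / real n"
    using assms by (simp add: power2_eq_square field_simps)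
  finally show ?thesis .
qed

text \<open>The free parameter \<open>t\<close> can be fixed once for all degrees, before averaging
  over the prior; afterwards only the mean of \<open>1 / n\<close> matters.\<close>

lemma Bernstein_mean_deviation_le:
  assumes "0 < n" "0 \<le> x" "x \<le> 1" "0 < t"
  shows "(\<Sum>k\<le>n. \<bar>real k / real n - x\<bar> * Bernstein n k x) \<le> t / 2 + 1 / (8 * t * real n)"
proof -
  \<comment> \<open>AM-GM instead of Cauchy-Schwarz keeps the bound linear in \<open>1 / n\<close>.\<close>
  have amgm: "\<bar>y\<bar> \<le> t / 2 + y\<^sup>2 / (2 * t)" for y :: real
  proof -
    have "0 \<le> (\<bar>y\<bar> - t)\<^sup>2" by simp
    then have "2 * t * \<bar>y\<bar> \<le> t\<^sup>2 + y\<^sup>2" by (simp add: power2_diff mult_ac)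
    then show ?thesis using \<open>0 < t\<close> by (simp add: field_simps power2_eq_square)
  qed
  have "x * (1 - x) \<le> 1 / 4"
    using zero_le_power2[of "x - 1 / 2"] by (simp add: power2_eq_square algebra_simps)
  then have var: "x * (1 - x) / (2 * t * real n) \<le> (1 / 4) / (2 * t * real n)"
    using assms by (intro divide_right_mono) auto
  have "(\<Sum>k\<le>n. \<bar>real k / real n - x\<bar> * Bernstein n k x)
      \<le> (\<Sum>k\<le>n. (t / 2 + (real k / real n - x)\<^sup>2 / (2 * t)) * Bernstein n k x)"
    using assms by (intro sum_mono mult_right_mono amgm Bernstein_nonneg)
  also have "\<dots> = t / 2 * (\<Sum>k\<le>n. Bernstein n k x)
      + 1 / (2 * t) * (\<Sum>k\<le>n. (real k / real n - x)\<^sup>2 * Bernstein n k x)"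
    by (simp only: sum_distrib_left sum.distrib[symmetric]) (simp add: algebra_simps)
  also have "\<dots> = t / 2 + x * (1 - x) / (2 * t * real n)"
    using assms by (simp only: Bernstein_variance) simp
  finally show ?thesis using var by simp
qed

section \<open>The ECBC as an average of checkerboard values with product Bernstein weights\<close>

lemma ecbc_eq_Bernstein:
  "ecbc x n m u = (\<Sum>k\<in>(\<Pi>\<^sub>E j\<in>UNIV. {0..m j}).
    checkerboard_copula x n (\<chi> j. real (k j) / real (m j)) *
    (\<Prod>j\<in>UNIV. Bernstein (m j) (k j) (u $ j)))"
  by (simp add: ecbc_def Bernstein_def)

lemma sum_prod_Bernstein:
  fixes m :: "'d::finite \<Rightarrow> nat" and u :: "real ^ 'd"
  shows "(\<Sum>k\<in>(\<Pi>\<^sub>E j\<in>UNIV. {0..m j}). \<Prod>j\<in>UNIV. Bernstein (m j) (k j) (u $ j)) = 1"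
  using sum_PiE_marginal[where m = m and w = "\<lambda>j k. Bernstein (m j) k (u $ j)" and h = "\<lambda>_. 1"] by simp

text \<open>Every factor is clamped to the unit interval, so the bounds hold at all points; for
  \<open>n = 0\<close> the convention \<open>1 / 0 = 0\<close> gives the value 0.\<close>

lemma checkerboard_copula_bounds:
  "0 \<le> checkerboard_copula x n u" "checkerboard_copula x n u \<le> 1"
proof -
  let ?s = "\<Sum>i<n. \<Prod>j\<in>UNIV.
    min (max (real n * u $ j - real (sample_rank x n i j) + 1) 0) 1"
  have "0 \<le> ?s"
    by (intro sum_nonneg prod_nonneg) auto
  moreover have "?s \<le> (\<Sum>i<n. 1)"
    by (intro sum_mono prod_le_1) auto
  ultimately show "0 \<le> checkerboard_copula x n u" "checkerboard_copula x n u \<le> 1"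
    by (auto simp: checkerboard_copula_def divide_simps)
qed

text \<open>On the cube the ECBC is a convex combination of checkerboard values. This covers degree
  vectors with zero entries, which belong to the space carrying the prior.\<close>

lemma ecbc_bounds:
  fixes m :: "'d::finite \<Rightarrow> nat"
  assumes "u \<in> unit_cube"
  shows "0 \<le> ecbc x n m u" "ecbc x n m u \<le> 1"
proof -
  have B: "0 \<le> (\<Prod>j\<in>UNIV. Bernstein (m j) (k j) (u $ j))" for k
    using assms by (intro prod_nonneg ballI Bernstein_nonneg) auto
  show "0 \<le> ecbc x n m u"
    unfolding ecbc_eq_Bernstein
    by (intro sum_nonneg mult_nonneg_nonneg checkerboard_copula_bounds B)
  have "ecbc x n m u
      \<le> (\<Sum>k\<in>(\<Pi>\<^sub>E j\<in>UNIV. {0..m j}). 1 * (\<Prod>j\<in>UNIV. Bernstein (m j) (k j) (u $ j)))"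
    unfolding ecbc_eq_Bernstein
    by (intro sum_mono mult_right_mono checkerboard_copula_bounds B)
  then show "ecbc x n m u \<le> 1"
    by (simp add: sum_prod_Bernstein)
qed

text \<open>The error splits at the grid point \<open>p k\<close>: the checkerboard error there is
  at most \<open>e\<close>, and the Lipschitz bound turns \<open>C (p k) - C u\<close> into a sum of
  coordinate deviations, whose weighted averages are one-dimensional.\<close>

lemma ecbc_approximation:
  fixes C :: "real ^ 'd \<Rightarrow> real" and m :: "'d \<Rightarrow> nat"
  assumes m: "\<And>j. 0 < m j" and u: "u \<in> unit_cube" and t: "0 < t"
    and close: "\<And>v. v \<in> unit_cube \<Longrightarrow> \<bar>checkerboard_copula x n v - C v\<bar> \<le> e"
    and lip: "\<And>v w. v \<in> unit_cube \<Longrightarrow> w \<in> unit_cube \<Longrightarrow> \<bar>C v - C w\<bar> \<le> (\<Sum>j\<in>UNIV. \<bar>v $ j - w $ j\<bar>)"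
  shows "\<bar>ecbc x n m u - C u\<bar> \<le> e + (\<Sum>j\<in>UNIV. t / 2 + 1 / (8 * t * real (m j)))"
proof -
  let ?K = "\<Pi>\<^sub>E j\<in>(UNIV::'d set). {0..m j}"
  define W where "W k = (\<Prod>j\<in>UNIV. Bernstein (m j) (k j) (u $ j))" for k
  define p :: "('d \<Rightarrow> nat) \<Rightarrow> real ^ 'd" where "p k = (\<chi> j. real (k j) / real (m j))" for k
  have W: "0 \<le> W k" for k
    unfolding W_def using u by (intro prod_nonneg ballI Bernstein_nonneg) auto
  have W1: "(\<Sum>k\<in>?K. W k) = 1"
    unfolding W_def by (rule sum_prod_Bernstein)
  have p: "p k \<in> unit_cube" if "k \<in> ?K" for k
    using that m by (auto simp: p_def PiE_iff divide_simps)
  have "ecbc x n m u - C u = (\<Sum>k\<in>?K. (checkerboard_copula x n (p k) - C u) * W k)"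
    using W1 by (simp add: ecbc_eq_Bernstein p_def[symmetric] W_def[symmetric] left_diff_distrib
        sum_subtractf flip: sum_distrib_left)
  also have "\<bar>\<dots>\<bar> \<le> (\<Sum>k\<in>?K. \<bar>(checkerboard_copula x n (p k) - C u) * W k\<bar>)"
    by (rule sum_abs)
  also have "\<dots> \<le> (\<Sum>k\<in>?K. (e + (\<Sum>j\<in>UNIV. \<bar>p k $ j - u $ j\<bar>)) * W k)"
  proof (rule sum_mono)
    fix k assume "k \<in> ?K"
    then have "\<bar>checkerboard_copula x n (p k) - C u\<bar> \<le> e + (\<Sum>j\<in>UNIV. \<bar>p k $ j - u $ j\<bar>)"
      using close[OF p[of k]] lip[OF p[of k] u] by linarith
    then show "\<bar>(checkerboard_copula x n (p k) - C u) * W k\<bar> \<le> (e + (\<Sum>j\<in>UNIV. \<bar>p k $ j - u $ j\<bar>)) * W k"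
      using W[of k] by (auto simp: abs_mult intro: mult_right_mono)
  qed
  also have "\<dots> = e + (\<Sum>j\<in>UNIV. \<Sum>k\<in>?K. \<bar>p k $ j - u $ j\<bar> * W k)"
    by (subst sum.swap)
      (simp add: distrib_right sum.distrib sum_distrib_right W1 flip: sum_distrib_left)
  \<comment> \<open>For fixed \<open>j\<close> the deviation depends on the single coordinate
    \<open>k j\<close>, so the other Bernstein factors sum out.\<close>
  also have "\<dots> = e + (\<Sum>j\<in>UNIV. \<Sum>k\<le>m j. \<bar>real k / real (m j) - u $ j\<bar> * Bernstein (m j) k (u $ j))"
    unfolding W_def p_def
    using sum_PiE_marginal[where m = m and w = "\<lambda>j k. Bernstein (m j) k (u $ j)"
        and h = "\<lambda>k. \<bar>real k / real (m j) - u $ j\<bar>" and i = j for j]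
    by simp
  also have "\<dots> \<le> e + (\<Sum>j\<in>UNIV. t / 2 + 1 / (8 * t * real (m j)))"
    using m u t by (intro add_left_mono sum_mono Bernstein_mean_deviation_le) auto
  finally show ?thesis .
qed

subsection \<open>The prior on the degrees\<close>

text \<open>Dividing the Poisson mass at \<open>k\<close> by \<open>k + 1\<close> gives the mass at
  \<open>Suc k\<close> divided by \<open>r\<close>; the shifted masses add up to the probability of
  \<open>range Suc\<close>, which is at most 1.\<close>

lemma nn_integral_poisson_inverse_Suc_le:
  assumes "0 < r"
  shows "(\<integral>\<^sup>+k. ennreal (1 / real (k + 1)) \<partial>measure_pmf (poisson_pmf r)) \<le> ennreal (1 / r)"
proof -
  have "(\<integral>\<^sup>+k. ennreal (1 / real (k + 1)) \<partial>measure_pmf (poisson_pmf r)) =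
      (\<integral>\<^sup>+k. ennreal (1 / r) * ennreal (pmf (poisson_pmf r) (Suc k)) \<partial>count_space UNIV)"
    unfolding nn_integral_measure_pmf using assms
    by (intro nn_integral_cong) (simp add: field_simps flip: ennreal_mult)
  also have "\<dots> = ennreal (1 / r) * (\<integral>\<^sup>+k. ennreal (pmf (poisson_pmf r) k) \<partial>count_space (range Suc))"
    by (simp add: nn_integral_cmult nn_integral_bij_count_space[symmetric, of Suc UNIV "range Suc"]
        bij_betw_def)
  also have "(\<integral>\<^sup>+k. ennreal (pmf (poisson_pmf r) k) \<partial>count_space (range Suc)) \<le> 1"
    by (simp add: nn_integral_pmf measure_pmf.emeasure_le_1)
  finally show ?thesis
    by (simp add: mult_left_mono)
qed

text \<open>A kernel is measurable once its mass on each set is. Here that mass is a countable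
  series of explicit measurable functions of \<open>f x\<close>.\<close>

lemma measurable_poisson_pmf:
  assumes [measurable]: "f \<in> borel_measurable M" and pos: "\<And>x. x \<in> space M \<Longrightarrow> 0 < f x"
  shows "(\<lambda>x. measure_pmf (poisson_pmf (f x))) \<in> M \<rightarrow>\<^sub>M subprob_algebra (count_space UNIV)"
proof (rule measurable_subprob_algebra)
  fix A :: "nat set"
  have "(\<lambda>x. emeasure (measure_pmf (poisson_pmf (f x))) A) \<in> borel_measurable M \<longleftrightarrow>
     (\<lambda>x. \<Sum>k. ennreal (f x ^ k / fact k * exp (- f x)) * indicator A k) \<in> borel_measurable M"
  proof (rule measurable_cong)
    fix x assume "x \<in> space M"
    then show "emeasure (measure_pmf (poisson_pmf (f x))) A =
        (\<Sum>k. ennreal (f x ^ k / fact k * exp (- f x)) * indicator A k)"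
      by (simp add: nn_integral_indicator[symmetric] nn_integral_measure_pmf
          nn_integral_count_space_nat pos del: nn_integral_indicator)
  qed
  then show "(\<lambda>x. emeasure (measure_pmf (poisson_pmf (f x))) A) \<in> borel_measurable M"
    by simp
qed (auto simp: measure_pmf.subprob_space_axioms)

abbreviation "alpha_prior \<equiv> uniform_measure lborel {1/3<..<2/3::real}"

lemma prob_space_alpha_prior: "prob_space alpha_prior"
  by (intro prob_space_uniform_measure) auto

text \<open>For \<open>0 < n\<close> the Poisson mean \<open>real n powr a\<close> is positive. The
  target \<open>prob_algebra\<close> is what makes the bind in \<open>pair_prior\<close> a
  probability measure.\<close>

lemma measurable_pair_kernel:
  assumes "0 < n"
  shows "(\<lambda>a. distr (measure_pmf (poisson_pmf (real n powr a)))
    (borel \<Otimes>\<^sub>M count_space UNIV) (\<lambda>k. (a, k + 1)))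
    \<in> alpha_prior \<rightarrow>\<^sub>M prob_algebra (borel \<Otimes>\<^sub>M count_space UNIV)"
proof (rule measurable_prob_algebraI)
  show "(\<lambda>a. distr (measure_pmf (poisson_pmf (real n powr a)))
    (borel \<Otimes>\<^sub>M count_space UNIV) (\<lambda>k. (a, k + 1)))
    \<in> alpha_prior \<rightarrow>\<^sub>M subprob_algebra (borel \<Otimes>\<^sub>M count_space UNIV)"
  proof (rule measurable_distr2[where M = "count_space UNIV"])
    show "(\<lambda>a. measure_pmf (poisson_pmf (real n powr a))) \<in> alpha_prior \<rightarrow>\<^sub>M subprob_algebra (count_space UNIV)"
      using assms by (intro measurable_poisson_pmf) auto
  qed (simp add: measurable_split_conv)
qed (auto intro!: measure_pmf.prob_space_distr simp: space_pair_measure)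

lemma
  assumes "0 < n"
  shows prob_space_pair_prior: "prob_space (pair_prior n)"
    and sets_pair_prior: "sets (pair_prior n) = sets (borel \<Otimes>\<^sub>M count_space UNIV)"
proof -
  have "alpha_prior \<in> space (prob_algebra alpha_prior)"
    by (simp add: space_prob_algebra prob_space_alpha_prior)
  from prob_space_bind'[OF this measurable_pair_kernel[OF assms]]
    sets_bind'[OF this measurable_pair_kernel[OF assms]]
  show "prob_space (pair_prior n)" "sets (pair_prior n) = sets (borel \<Otimes>\<^sub>M count_space UNIV)"
    by (simp_all add: pair_prior_def)
qed

lemma nn_integral_pair_prior:
  assumes "0 < n"
  shows "(\<integral>\<^sup>+p. g (snd p) \<partial>pair_prior n) =
    (\<integral>\<^sup>+a. \<integral>\<^sup>+k. g (k + 1) \<partial>measure_pmf (poisson_pmf (real n powr a)) \<partial>alpha_prior)"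
proof -
  have "(\<integral>\<^sup>+p. g (snd p) \<partial>pair_prior n) = (\<integral>\<^sup>+a. \<integral>\<^sup>+p. g (snd p) \<partial>distr (measure_pmf (poisson_pmf (real n powr a)))
    (borel \<Otimes>\<^sub>M count_space UNIV) (\<lambda>k. (a, k + 1)) \<partial>alpha_prior)"
    unfolding pair_prior_def
    by (rule nn_integral_bind[OF _ measurable_prob_algebraD[OF measurable_pair_kernel[OF assms]]])
      measurable
  also have "\<dots> = (\<integral>\<^sup>+a. \<integral>\<^sup>+k. g (k + 1) \<partial>measure_pmf (poisson_pmf (real n powr a)) \<partial>alpha_prior)"
    by (intro nn_integral_cong) (subst nn_integral_distr, auto simp: space_pair_measure)
  finally show ?thesis .
qed

text \<open>The final error bound is a sum of functions of single degrees, so its expectation is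
  reached through one-coordinate margins of the product prior.\<close>

lemma
  assumes "0 < n"
  shows prob_space_degree_prior: "prob_space (degree_prior n :: ('d::finite \<Rightarrow> nat) measure)"
    and nn_integral_degree_prior:
      "(\<integral>\<^sup>+m. g (m (j::'d)) \<partial>degree_prior n) = (\<integral>\<^sup>+p. g (snd p) \<partial>pair_prior n)"
proof -
  let ?P = "\<Pi>\<^sub>M j\<in>(UNIV::'d set). pair_prior n"
  note [measurable_cong] = sets_pair_prior[OF assms]
  have meas: "(\<lambda>w j. snd (w j)) \<in> ?P \<rightarrow>\<^sub>M (\<Pi>\<^sub>M j\<in>(UNIV::'d set). count_space UNIV)"
    by (intro measurable_PiM_single') (auto simp: PiE_iff)
  interpret P: prob_space ?P
    by (intro prob_space_PiM prob_space_pair_prior assms)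
  show "prob_space (degree_prior n :: ('d \<Rightarrow> nat) measure)"
    unfolding degree_prior_def by (rule P.prob_space_distr[OF meas])
  have "(\<integral>\<^sup>+m. g (m (j::'d)) \<partial>degree_prior n) = (\<integral>\<^sup>+w. g (snd (w j)) \<partial>?P)"
    unfolding degree_prior_def by (rule nn_integral_distr[OF meas]) measurable
  also have "\<dots> = (\<integral>\<^sup>+p. g (snd p) \<partial>distr ?P (pair_prior n) (\<lambda>w. w j))"
    by (rule nn_integral_distr[symmetric]) measurable
  also have "distr ?P (pair_prior n) (\<lambda>w. w j) = pair_prior n"
    by (rule distr_PiM_component[OF prob_space_pair_prior[OF assms]]) auto
  finally show "(\<integral>\<^sup>+m. g (m (j::'d)) \<partial>degree_prior n) = (\<integral>\<^sup>+p. g (snd p) \<partial>pair_prior n)" .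
qed

text \<open>Given \<open>a\<close>, the degree is \<open>k + 1\<close> with Poisson
  \<open>k\<close>, so the branch with the arbitrary value \<open>b\<close> is never met. The
  Poisson estimate gives \<open>1 / real n powr a\<close>, and \<open>1/3 < a\<close> together with
  \<open>1 \<le> n\<close> makes the bound uniform in \<open>a\<close>.\<close>

lemma nn_integral_degree_prior_inverse_le:
  fixes j :: "'d::finite"
  assumes n: "0 < n" and t: "0 < t" and s: "0 \<le> s"
  shows "(\<integral>\<^sup>+m. ennreal (if m j = 0 then b else s + 1 / (t * real (m j))) \<partial>degree_prior n)
    \<le> ennreal s + ennreal (1 / (t * real n powr (1/3)))"
proof -
  have inner: "(\<integral>\<^sup>+k. ennreal (s + 1 / (t * real (k + 1))) \<partial>measure_pmf (poisson_pmf (real n powr a)))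
      \<le> ennreal s + ennreal (1 / (t * real n powr (1/3)))" if a: "a \<in> {1/3<..<2/3}" for a
  proof -
    have "(\<integral>\<^sup>+k. ennreal (s + 1 / (t * real (k + 1))) \<partial>measure_pmf (poisson_pmf (real n powr a)))
      \<le> (\<integral>\<^sup>+k. ennreal s + ennreal (1 / t) * ennreal (1 / real (k + 1)) \<partial>measure_pmf (poisson_pmf (real n powr a)))"
      using s t by (intro nn_integral_mono) (simp flip: ennreal_mult ennreal_plus)
    also have "\<dots> = ennreal s + ennreal (1 / t) *
        (\<integral>\<^sup>+k. ennreal (1 / real (k + 1)) \<partial>measure_pmf (poisson_pmf (real n powr a)))"
      by (subst nn_integral_add) (simp_all add: nn_integral_cmult measure_pmf.emeasure_space_1)
    also have "\<dots> \<le> ennreal s + ennreal (1 / t) * ennreal (1 / real n powr a)"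
      using n by (intro add_left_mono mult_left_mono nn_integral_poisson_inverse_Suc_le) auto
    also have "\<dots> = ennreal s + ennreal (1 / (t * real n powr a))"
      using t by (simp flip: ennreal_mult)
    also have "\<dots> \<le> ennreal s + ennreal (1 / (t * real n powr (1/3)))"
      using n t a
      by (intro add_left_mono ennreal_leI divide_left_mono mult_left_mono powr_mono) auto
    finally show ?thesis .
  qed
  interpret prob_space alpha_prior by (rule prob_space_alpha_prior)
  have "(\<integral>\<^sup>+m. ennreal (if m j = 0 then b else s + 1 / (t * real (m j))) \<partial>degree_prior n)
     = (\<integral>\<^sup>+a. \<integral>\<^sup>+k. ennreal (s + 1 / (t * real (k + 1)))
         \<partial>measure_pmf (poisson_pmf (real n powr a)) \<partial>alpha_prior)"
    using nn_integral_degree_prior[OF n, of "\<lambda>k. ennreal (if k = 0 then b else s + 1 / (t * real k))" j]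
      nn_integral_pair_prior[OF n, of "\<lambda>k. ennreal (if k = 0 then b else s + 1 / (t * real k))"]
    by simp
  also have "\<dots> \<le> (\<integral>\<^sup>+a. ennreal s + ennreal (1 / (t * real n powr (1/3))) \<partial>alpha_prior)"
    using inner by (intro nn_integral_mono_AE AE_uniform_measureI) auto
  also have "\<dots> = ennreal s + ennreal (1 / (t * real n powr (1/3)))"
    by (simp only: nn_integral_const emeasure_space_1) simp
  finally show ?thesis .
qed

subsection \<open>Almost sure convergence of frequencies\<close>

text \<open>The indicators of \<open>A\<close> are i.i.d. with values in the unit interval, so
  Hoeffding's bound on a fixed deviation is geometric in \<open>n\<close>, hence summable, and
  Borel-Cantelli applies.\<close>

lemma (in prob_space) frequency_tendsto_prob:
  fixes X :: "nat \<Rightarrow> 'a \<Rightarrow> 'b"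
  assumes indep: "indep_vars (\<lambda>_. N) X UNIV"
    and ident: "\<And>i. distr M N (X i) = distr M N (X 0)"
    and A[measurable]: "A \<in> sets N"
  shows "AE \<omega> in M. (\<lambda>n. real (card {i. i < n \<and> X i \<omega> \<in> A}) / real n)
    \<longlonglongrightarrow> measure (distr M N (X 0)) A"
proof -
  define Y where "Y i \<omega> = (indicator A (X i \<omega>) :: real)" for i \<omega>
  define p where "p = measure (distr M N (X 0)) A"
  have X[measurable]: "X i \<in> M \<rightarrow>\<^sub>M N" for i
    using indep by (auto simp: indep_vars_def)
  have Y[measurable]: "Y i \<in> borel_measurable M" for i
    unfolding Y_def by measurable
  have indepY: "indep_vars (\<lambda>_. borel) Y I" for I
    unfolding Y_def
    by (rule indep_vars_compose2[OF indep_vars_subset[OF indep]]) auto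
  have distrY: "distr M borel (Y i) = distr M borel (Y 0)" for i
  proof -
    have "distr M borel (Y i) = distr (distr M N (X i)) borel (indicator A)" for i
      by (subst distr_distr) (auto simp: Y_def[abs_def] comp_def)
    then show ?thesis by (simp only: ident[of i])
  qed
  have EY: "expectation (Y 0) = p"
  proof -
    have "expectation (Y 0) = (\<integral>y. indicator A y \<partial>distr M N (X 0))"
      unfolding Y_def by (subst integral_distr) auto
    then show ?thesis by (simp add: p_def)
  qed
  have freq: "real (card {i. i < n \<and> X i \<omega> \<in> A}) = (\<Sum>i<n. Y i \<omega>)" for n \<omega>
  proof -
    have "{i. i < n \<and> X i \<omega> \<in> A} = {..<n} \<inter> {i. X i \<omega> \<in> A}" by auto
    then show ?thesis by (simp add: Y_def indicator_def sum.If_cases)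
  qed
  have tail: "AE \<omega> in M. eventually (\<lambda>n. \<bar>(\<Sum>i<n. Y i \<omega>) / real n - p\<bar> < e) sequentially"
    if "e > 0" for e :: real
  proof -
    define B where "B n = {\<omega> \<in> space M. \<bar>(\<Sum>i<n. Y i \<omega>) / real n - p\<bar> \<ge> e}" for n
    have [measurable]: "B n \<in> sets M" for n
      unfolding B_def by measurable
    have bound: "prob (B n) \<le> 2 * exp (- 2 * e\<^sup>2) ^ n" if "n \<ge> 1" for n
    proof -
      interpret Hoeffding_ineq_iid M "{..<n}" Y "Y 0" 0 1 p
        by unfold_locales (use indepY distrY EY in \<open>auto simp: Y_def indicator_def\<close>)
      have "prob (B n) \<le> 2 * exp (-2 * real n * e\<^sup>2)"
        using Hoeffding_ineq_abs_ge'[of e] \<open>e > 0\<close> that by (auto simp: B_def lessThan_empty_iff)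
      then show ?thesis
        by (simp add: exp_of_nat_mult[symmetric] mult_ac)
    qed
    have "summable (\<lambda>n. 2 * exp (- 2 * e\<^sup>2) ^ n)"
      using that by (intro summable_mult summable_geometric) simp
    \<comment> \<open>The comparison starts at \<open>n = 1\<close> because the tail bound is for
      nonempty samples.\<close>
    then have "summable (\<lambda>n. prob (B n))"
      by (rule summable_comparison_test'[where N = 1]) (simp only: real_norm_def abs_of_nonneg measure_nonneg bound)
    then have "AE \<omega> in M. eventually (\<lambda>n. \<omega> \<in> space M - B n) sequentially"
      by (intro borel_cantelli_AE1) (auto simp: less_top[symmetric])
    then show ?thesis
      by eventually_elim (auto elim!: eventually_mono simp: B_def)
  qed
  \<comment> \<open>Restricting to the tolerances \<open>1 / Suc k\<close> leaves countably many
    null sets to unite.\<close>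
  have "AE \<omega> in M. \<forall>k. eventually (\<lambda>n. \<bar>(\<Sum>i<n. Y i \<omega>) / real n - p\<bar> < 1 / real (Suc k)) sequentially"
    unfolding AE_all_countable by (intro allI tail) simp
  then show ?thesis
  proof eventually_elim
    case (elim \<omega>)
    show ?case unfolding freq p_def[symmetric]
    proof (rule tendstoI)
      fix e :: real assume "e > 0"
      then obtain k where "1 / real (Suc k) < e" using nat_approx_posE by blast
      with elim[rule_format, of k]
      show "\<forall>\<^sub>F n in sequentially. dist ((\<Sum>i<n. Y i \<omega>) / real n) p < e"
        by (auto simp: dist_real_def elim: eventually_mono)
    qed
  qed
qed

subsection \<open>Distributions with uniform margins\<close>

text \<open>At such a point the joint distribution function of a law on the cube reduces to its
  margin \<open>j\<close>. Convergence of joint frequencies at grid points thereby includes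
  convergence of the marginal ones.\<close>

definition margin_point :: "'d \<Rightarrow> real \<Rightarrow> real ^ 'd" where
  "margin_point j t = (\<chi> k. if k = j then t else 1)"

text \<open>Uniformity is expressed through distribution functions: \<open>max 0 (min 1 t)\<close>
  is the uniform one, extended to the whole line.\<close>

definition has_uniform_margins :: "(real ^ 'd) measure \<Rightarrow> bool" where
  "has_uniform_margins \<nu> \<longleftrightarrow> prob_space \<nu> \<and> sets \<nu> = sets borel \<and>
    (\<forall>j t. measure \<nu> {y. y $ j \<le> t} = max 0 (min 1 t))"

lemma borel_measurable_vec_nth [measurable]:
  "(\<lambda>y :: real ^ 'd. y $ j) \<in> borel_measurable borel"
  by (intro borel_measurable_continuous_onI continuous_intros)

lemma borel_measurable_vec_lambda:
  fixes f :: "'d::finite \<Rightarrow> 'a \<Rightarrow> real"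
  assumes "\<And>j. f j \<in> borel_measurable M"
  shows "(\<lambda>x. \<chi> j. f j x) \<in> borel_measurable M"
  unfolding borel_measurable_euclidean_space[where 'c = "real ^ 'd"]
  using assms by (auto simp: Basis_vec_def inner_axis)

lemma joint_cdf_mono:
  assumes "prob_space \<nu>" "sets \<nu> = sets borel" "\<And>j. v $ j \<le> w $ j"
  shows "joint_cdf \<nu> v \<le> joint_cdf \<nu> w"
proof -
  interpret prob_space \<nu> by fact
  show ?thesis unfolding joint_cdf_def
    using assms by (intro finite_measure_mono) (auto intro: order_trans)
qed

text \<open>A point below \<open>v\<close> but not below \<open>w\<close> lies, for some
  \<open>j\<close>, in the strip between \<open>w $ j\<close> and \<open>v $ j\<close>. By
  uniformity the strip has mass at most the coordinate distance, and the union bound adds these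
  up.\<close>

lemma joint_cdf_diff_le:
  fixes v w :: "real ^ 'd"
  assumes "has_uniform_margins \<nu>"
  shows "joint_cdf \<nu> v - joint_cdf \<nu> w \<le> (\<Sum>j\<in>UNIV. \<bar>v $ j - w $ j\<bar>)"
proof -
  interpret prob_space \<nu> using assms by (simp add: has_uniform_margins_def)
  have [measurable_cong]: "sets \<nu> = sets borel"
    using assms by (simp add: has_uniform_margins_def)
  have [simp]: "space \<nu> = UNIV"
    using sets_eq_imp_space_eq[OF \<open>sets \<nu> = sets borel\<close>] by simp
  let ?S = "\<lambda>j. {y. y $ j \<le> v $ j} - {y :: real ^ 'd. y $ j \<le> w $ j}"
  have [measurable]: "{y. y $ j \<le> t} \<in> sets \<nu>" for j t
    using \<open>sets \<nu> = sets borel\<close> by simp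
  have strip: "prob (?S j) \<le> \<bar>v $ j - w $ j\<bar>" for j
  proof (cases "v $ j \<le> w $ j")
    case True
    then have "?S j = {}" by auto
    then show ?thesis by (simp only: measure_empty abs_ge_zero)
  next
    case False
    then have "prob (?S j) = prob {y. y $ j \<le> v $ j} - prob {y. y $ j \<le> w $ j}"
      by (intro finite_measure_Diff) auto
    also have "\<dots> = max 0 (min 1 (v $ j)) - max 0 (min 1 (w $ j))"
      using assms by (simp add: has_uniform_margins_def)
    finally show ?thesis by linarith
  qed
  have "joint_cdf \<nu> v \<le> prob ({y. \<forall>j. y $ j \<le> w $ j} \<union> (\<Union>j\<in>UNIV. ?S j))"
    unfolding joint_cdf_def by (intro finite_measure_mono) auto
  also have "\<dots> \<le> prob {y. \<forall>j. y $ j \<le> w $ j} + prob (\<Union>j\<in>UNIV. ?S j)"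
    by (intro measure_Un_le) auto
  also have "prob (\<Union>j\<in>UNIV. ?S j) \<le> (\<Sum>j\<in>UNIV. prob (?S j))"
    by (intro finite_measure_subadditive_finite) auto
  also have "\<dots> \<le> (\<Sum>j\<in>UNIV. \<bar>v $ j - w $ j\<bar>)"
    by (intro sum_mono strip)
  finally show ?thesis by (simp add: joint_cdf_def)
qed

lemma joint_cdf_lipschitz:
  assumes "has_uniform_margins \<nu>"
  shows "\<bar>joint_cdf \<nu> v - joint_cdf \<nu> w\<bar> \<le> (\<Sum>j\<in>UNIV. \<bar>v $ j - w $ j\<bar>)"
  using joint_cdf_diff_le[OF assms, of v w] joint_cdf_diff_le[OF assms, of w v]
  by (simp add: abs_le_iff abs_minus_commute)

text \<open>Uniform margins give almost surely \<open>y $ k \<le> 1\<close> for all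
  \<open>k\<close>, so only the constraint on coordinate \<open>j\<close> remains.\<close>

lemma joint_cdf_margin_point:
  assumes "has_uniform_margins \<nu>"
  shows "joint_cdf \<nu> (margin_point j t) = max 0 (min 1 t)"
proof -
  interpret prob_space \<nu> using assms by (simp add: has_uniform_margins_def)
  have s: "sets \<nu> = sets borel"
    using assms by (simp add: has_uniform_margins_def)
  have [simp]: "space \<nu> = UNIV"
    using sets_eq_imp_space_eq[OF s] by simp
  have "AE y in \<nu>. y $ k \<le> 1" for k
    using assms prob_Collect_eq_1[of "\<lambda>y. y $ k \<le> 1"] s by (simp add: has_uniform_margins_def)
  then have "AE y in \<nu>. \<forall>k. y $ k \<le> 1"
    by (simp add: AE_all_countable)
  then have "measure \<nu> {y. \<forall>k. y $ k \<le> margin_point j t $ k} = measure \<nu> {y. y $ j \<le> t}"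
    using s by (intro measure_eq_AE) (auto simp: margin_point_def elim!: eventually_mono)
  then show ?thesis
    using assms by (simp add: joint_cdf_def has_uniform_margins_def)
qed

lemma measure_uniform_unit_atMost:
  "measure (uniform_measure lborel {0..1::real}) {..t} = max 0 (min 1 t)"
proof -
  have "{0..1} \<inter> {..t} = {0..min 1 t}" by auto
  then show ?thesis by (simp add: max_def)
qed

lemma is_copula_imp_uniform_margins:
  fixes C :: "real ^ 'd \<Rightarrow> real"
  assumes "is_copula C"
  obtains \<mu> :: "(real ^ 'd) measure" where "has_uniform_margins \<mu>"
    "\<And>u. u \<in> unit_cube \<Longrightarrow> C u = joint_cdf \<mu> u"
proof -
  obtain \<mu> :: "(real ^ 'd) measure" where p: "prob_space \<mu>" and s: "sets \<mu> = sets borel"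
    and d: "\<And>j. distr \<mu> borel (\<lambda>y. y $ j) = uniform_measure lborel {0..1}"
    and C: "\<And>u. u \<in> unit_cube \<Longrightarrow> C u = joint_cdf \<mu> u"
    using assms by (auto simp: is_copula_def)
  note [measurable_cong] = s
  have "measure \<mu> {y. y $ j \<le> t} = max 0 (min 1 t)" for j t
  proof -
    have "measure \<mu> {y. y $ j \<le> t} = measure (distr \<mu> borel (\<lambda>y. y $ j)) {..t}"
      using sets_eq_imp_space_eq[OF s] by (subst measure_distr) (auto simp: vimage_def)
    then show ?thesis by (simp only: d measure_uniform_unit_atMost)
  qed
  then show thesis
    using C p s by (intro that[of \<mu>]) (simp_all add: has_uniform_margins_def)
qed

section \<open>Continuous distribution functions and the probability integral transform\<close>

lemma (in real_distribution) cdf_surj: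
  assumes "\<And>x. isCont (cdf M) x" "0 < t" "t < 1"
  shows "\<exists>x. cdf M x = t"
proof -
  have "eventually (\<lambda>x. cdf M x < t) at_bot"
    using order_tendstoD(2)[OF cdf_lim_at_bot] assms by simp
  then obtain a where a: "\<And>x. x \<le> a \<Longrightarrow> cdf M x < t" by (auto simp: eventually_at_bot_linorder)
  have "eventually (\<lambda>x. cdf M x > t) at_top"
    using order_tendstoD(1)[OF cdf_lim_at_top_prob] assms by simp
  then obtain b where b: "\<And>x. x \<ge> b \<Longrightarrow> cdf M x > t" by (auto simp: eventually_at_top_linorder)
  have "a \<le> b" using a[of a] b[of a] by (cases "a \<le> b") auto
  then show ?thesis
    using IVT[of "cdf M" a t b] a[of a] b[of b] assms by fastforce
qed

text \<open>This is the probability integral transform. The cdf may have flat pieces, so the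
  sublevel set is compared with half-lines ending at points of prescribed cdf value: level
  \<open>t\<close> from below, levels slightly above \<open>t\<close> from above.\<close>

lemma (in real_distribution) prob_cdf_le:
  assumes cont: "\<And>x. isCont (cdf M) x"
  shows "prob {x. cdf M x \<le> t} = max 0 (min 1 t)"
proof -
  have [measurable]: "cdf M \<in> borel_measurable borel"
    by (intro borel_measurable_mono monoI cdf_nondecreasing)
  have S[measurable]: "{x. cdf M x \<le> t} \<in> sets M" for t
    by simp
  \<comment> \<open>The gap \<open>t < s\<close> deals with flat pieces:
    \<open>cdf M y \<le> t < cdf M x\<close> forces \<open>y \<le> x\<close>, whereas a flat piece
    at level \<open>t\<close> may continue to the right of a given point at that level.\<close>
  have le: "prob {x. cdf M x \<le> t} \<le> s" if "t < s" "0 < s" "s < 1" for t s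
  proof -
    obtain x where x: "cdf M x = s" using cdf_surj[OF cont \<open>0 < s\<close> \<open>s < 1\<close>] by blast
    have "{y. cdf M y \<le> t} \<subseteq> {..x}"
      proof (intro subsetI)
      fix y assume "y \<in> {y. cdf M y \<le> t}"
      then show "y \<in> {..x}"
        using x \<open>t < s\<close> cdf_nondecreasing[of x y] by (cases "x \<le> y") auto
    qed
    then have "prob {y. cdf M y \<le> t} \<le> prob {..x}"
      by (intro finite_measure_mono) auto
    then show ?thesis using x by (simp add: cdf_def)
  qed
  have ge: "t \<le> prob {x. cdf M x \<le> t}" if "0 < t" "t < 1" for t
  proof -
    obtain x where x: "cdf M x = t" using cdf_surj[OF cont \<open>0 < t\<close> \<open>t < 1\<close>] by blast
    have "{..x} \<subseteq> {y. cdf M y \<le> t}"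
      using x cdf_nondecreasing[of _ x] by auto
    then have "prob {..x} \<le> prob {y. cdf M y \<le> t}"
      by (intro finite_measure_mono) auto
    then show ?thesis using x by (simp add: cdf_def)
  qed
  consider "1 \<le> t" | "0 < t" "t < 1" | "t \<le> 0" by linarith
  then show ?thesis
  proof cases
    case 1
    then have "{x. cdf M x \<le> t} = UNIV"
      using cdf_bounded_prob order_trans by blast
    then show ?thesis using 1 prob_space by simp
  next
    case 2
    have "prob {x. cdf M x \<le> t} \<le> t"
    proof (rule field_le_epsilon)
      fix e :: real assume "0 < e"
      \<comment> \<open>This level exceeds \<open>t\<close> and stays below 1, where
        \<open>cdf_surj\<close> still supplies a point.\<close>
      then have "prob {x. cdf M x \<le> t} \<le> min (t + e) ((t + 1) / 2)"
        using 2 by (intro le) (auto simp: min_def)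
      then show "prob {x. cdf M x \<le> t} \<le> t + e" by simp
    qed
    with ge[OF 2] 2 show ?thesis by simp
  next
    case 3
    have "prob {x. cdf M x \<le> t} \<le> 0"
    proof (rule field_le_epsilon)
      fix e :: real assume "0 < e"
      then have "prob {x. cdf M x \<le> t} \<le> min e (1 / 2)"
        using 3 by (intro le) (auto simp: min_def)
      then show "prob {x. cdf M x \<le> t} \<le> 0 + e" by simp
    qed
    with 3 show ?thesis by (simp add: measure_le_0_iff)
  qed
qed

lemma absolutely_continuous_function_imp_isCont:
  assumes "absolutely_continuous_function f"
  shows "isCont f x"
  unfolding continuous_at_eps_delta
proof -
  show "\<forall>e>0. \<exists>d>0. \<forall>y. dist y x < d \<longrightarrow> dist (f y) (f x) < e"
  proof (intro allI impI)
    fix e :: real assume "e > 0"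
    then obtain d where "d > 0" and d: "\<And>I :: (real \<times> real) set.
       finite I \<and> (\<forall>(a, b)\<in>I. a \<le> b) \<and> disjoint_family_on (\<lambda>(a, b). {a<..<b}) I \<and>
       (\<Sum>(a, b)\<in>I. b - a) < d \<longrightarrow> (\<Sum>(a, b)\<in>I. \<bar>f b - f a\<bar>) < e"
      using assms unfolding absolutely_continuous_function_def by meson
    \<comment> \<open>A family consisting of a single interval turns absolute continuity into
      continuity.\<close>
    have "dist (f y) (f x) < e" if "dist y x < d" for y
      using d[of "{(min x y, max x y)}"] that
      by (auto simp: disjoint_family_on_def dist_real_def min_def max_def abs_minus_commute
          split: if_splits)
    then show "\<exists>d>0. \<forall>y. dist y x < d \<longrightarrow> dist (f y) (f x) < e"
      using \<open>d > 0\<close> by blast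
  qed
qed

text \<open>By monotonicity \<open>y \<le> x\<close> coordinatewise implies
  \<open>G y \<le> G x\<close>, which gives \<open>C v \<le> joint_cdf \<nu> v\<close>; the reverse
  comparison needs a point \<open>w\<close> strictly above \<open>v\<close>. Both require quantiles,
  hence the open cube. The Lipschitz bounds then close the gap and reach the boundary.\<close>

lemma
  fixes P :: "(real ^ 'd) measure" and C :: "real ^ 'd \<Rightarrow> real"
  assumes "prob_space P" and sets_P: "sets P = sets borel"
    and G: "\<And>j. G j = cdf (distr P borel (\<lambda>y. y $ j))"
    and cont: "\<And>j x. isCont (G j) x"
    and mu: "has_uniform_margins \<mu>" "\<And>u. u \<in> unit_cube \<Longrightarrow> C u = joint_cdf \<mu> u"
    and sklar: "\<And>x. joint_cdf P x = C (\<chi> j. G j (x $ j))"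
  defines "\<nu> \<equiv> distr P borel (\<lambda>y. \<chi> j. G j (y $ j))"
  shows has_uniform_margins_transform: "has_uniform_margins \<nu>"
    and joint_cdf_transform: "\<And>u. u \<in> unit_cube \<Longrightarrow> joint_cdf \<nu> u = C u"
proof -
  interpret P: prob_space P by fact
  note [measurable_cong] = sets_P
  have [simp]: "space P = UNIV"
    using sets_eq_imp_space_eq[OF sets_P] by simp
  have rd: "real_distribution (distr P borel (\<lambda>y. y $ j))" for j
    by (rule P.real_distribution_distr) measurable
  have mono: "mono (G j)" for j
    unfolding G
    by (intro monoI finite_borel_measure.cdf_nondecreasing real_distribution.finite_borel_measure_M rd)
  have [measurable]: "G j \<in> borel_measurable borel" for j
    by (intro borel_measurable_mono mono)
  have phi[measurable]: "(\<lambda>y. \<chi> j. G j (y $ j)) \<in> P \<rightarrow>\<^sub>M borel"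
    by (intro borel_measurable_vec_lambda) measurable
  have nu_eq: "measure \<nu> A = measure P {y. (\<chi> j. G j (y $ j)) \<in> A}" if "A \<in> sets borel" for A
    unfolding \<nu>_def using that by (subst measure_distr) (auto simp: vimage_def)
  show unif: "has_uniform_margins \<nu>"
    unfolding has_uniform_margins_def
  proof (intro conjI allI)
    show "prob_space \<nu>" unfolding \<nu>_def by (rule P.prob_space_distr[OF phi])
    fix j t
    have "measure \<nu> {y. y $ j \<le> t} = measure P {y. G j (y $ j) \<le> t}"
      by (subst nu_eq) auto
    also have "\<dots> = measure (distr P borel (\<lambda>y. y $ j)) {x. G j x \<le> t}"
      by (subst measure_distr) (auto simp: vimage_def)
    also have "\<dots> = max 0 (min 1 t)"
      using real_distribution.prob_cdf_le[OF rd, of j t] cont by (simp add: G)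
    finally show "measure \<nu> {y. y $ j \<le> t} = max 0 (min 1 t)" .
  qed (simp add: \<nu>_def)
  have joint_nu: "joint_cdf \<nu> v = measure P {y. \<forall>j. G j (y $ j) \<le> v $ j}" for v
    unfolding joint_cdf_def by (subst nu_eq) auto
  have meas_nu[measurable]: "{y. \<forall>j. G j (y $ j) \<le> v $ j} \<in> sets P" for v
    by measurable
  have quantile: "\<exists>x. (\<chi> j. G j (x $ j)) = v" if "\<And>j. 0 < v $ j" "\<And>j. v $ j < 1" for v :: "real ^ 'd"
  proof -
    have "\<forall>j. \<exists>x. G j x = v $ j"
      using real_distribution.cdf_surj[OF rd] cont that by (simp add: G)
    then obtain q where "\<And>j. G j (q j) = v $ j" by metis
    then show ?thesis by (intro exI[of _ "\<chi> j. q j"]) (simp add: vec_eq_iff)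
  qed
  have lower: "C v \<le> joint_cdf \<nu> v" if v: "\<And>j. 0 < v $ j" "\<And>j. v $ j < 1" for v
  proof -
    obtain x where x: "(\<chi> j. G j (x $ j)) = v" using quantile v by blast
    have "C v = joint_cdf P x" by (simp only: sklar x)
    also have "\<dots> \<le> joint_cdf \<nu> v"
      unfolding joint_nu unfolding joint_cdf_def x[symmetric]
      by (intro P.finite_measure_mono) (auto intro: monoD[OF mono])
    finally show ?thesis .
  qed
  have upper: "joint_cdf \<nu> v \<le> C w"
    if w: "\<And>j. 0 < w $ j" "\<And>j. w $ j < 1" "\<And>j. v $ j < w $ j" for v w
  proof -
    obtain x where x: "(\<chi> j. G j (x $ j)) = w" using quantile w by blast
    have *: "y $ j \<le> x $ j" if "\<forall>j. G j (y $ j) \<le> v $ j" for y j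
    proof (rule ccontr)
      assume "\<not> y $ j \<le> x $ j"
      then have "G j (x $ j) \<le> G j (y $ j)" by (intro monoD[OF mono]) simp
      moreover have "G j (x $ j) = w $ j" using x by auto
      ultimately show False using that w(3)[of j] by (auto simp: not_less[symmetric] dest: spec[of _ j])
    qed
    have "joint_cdf \<nu> v \<le> joint_cdf P x"
      unfolding joint_nu unfolding joint_cdf_def using sets_P *
      by (intro P.finite_measure_mono) auto
    also have "\<dots> = C w" by (simp only: sklar x)
    finally show ?thesis .
  qed
  fix u :: "real ^ 'd" assume u: "u \<in> unit_cube"
  let ?d = "real CARD('d)"
  have lip: "\<bar>C v - C w\<bar> \<le> ?d * e"
    if "v \<in> unit_cube" "w \<in> unit_cube" "\<And>j. \<bar>v $ j - w $ j\<bar> \<le> e" for v w e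
    using joint_cdf_lipschitz[OF mu(1), of v w] sum_bounded_above[of UNIV "\<lambda>j. \<bar>v $ j - w $ j\<bar>" e] that
    by (simp add: mu(2))
  \<comment> \<open>Clipping to \<open>[e, 1 - e]\<close> and then adding \<open>e / 2\<close> keeps
    both \<open>v\<close> and \<open>w\<close> in the open cube. The upper estimate costs
    \<open>?d * e\<close> from \<open>u\<close> to \<open>v\<close> and \<open>?d * (2 * e)\<close>
    from \<open>w\<close> back to \<open>u\<close>, hence the factor 3.\<close>
  have close: "\<bar>joint_cdf \<nu> u - C u\<bar> \<le> 3 * ?d * e" if e: "0 < e" "e < 1 / 2" for e
  proof -
    define v :: "real ^ 'd" where "v = (\<chi> j. max e (min (1 - e) (u $ j)))"
    define w :: "real ^ 'd" where "w = (\<chi> j. v $ j + e / 2)"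
    have v: "0 < v $ j" "v $ j < 1" "\<bar>u $ j - v $ j\<bar> \<le> e" for j
      using e u by (auto simp: v_def abs_le_iff min_def max_def)
    have w: "0 < w $ j" "w $ j < 1" "v $ j < w $ j" "\<bar>w $ j - u $ j\<bar> \<le> 2 * e" for j
      using e u v(3)[of j] by (auto simp: v_def w_def abs_le_iff min_def max_def)
    have vw: "v \<in> unit_cube" "w \<in> unit_cube"
      using v(1,2) w(1,2) by (auto intro: less_imp_le)
    have "\<bar>joint_cdf \<nu> u - joint_cdf \<nu> v\<bar> \<le> ?d * e"
      using joint_cdf_lipschitz[OF unif, of u v] sum_bounded_above[of UNIV "\<lambda>j. \<bar>u $ j - v $ j\<bar>" e] v(3)
      by simp
    moreover have "C v \<le> joint_cdf \<nu> v" "joint_cdf \<nu> v \<le> C w"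
      using lower[of v] upper[of w v] v w by auto
    moreover have "\<bar>C u - C v\<bar> \<le> ?d * e" "\<bar>C w - C u\<bar> \<le> ?d * (2 * e)"
      using lip[OF u vw(1) v(3)] lip[OF vw(2) u w(4)] by auto
    ultimately show ?thesis by (simp add: abs_le_iff)
  qed
  have "\<bar>joint_cdf \<nu> u - C u\<bar> \<le> 0"
  proof (rule field_le_epsilon)
    fix e :: real assume "0 < e"
    define e' where "e' = min (e / (3 * ?d)) (1 / 3)"
    have "0 < e'" "e' < 1 / 2" "3 * ?d * e' \<le> e"
      using \<open>0 < e\<close> by (auto simp: e'_def min_def field_simps)
    with close[of e'] show "\<bar>joint_cdf \<nu> u - C u\<bar> \<le> 0 + e" by simp
  qed
  then show "joint_cdf \<nu> u = C u" by simp
qed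

subsection \<open>The empirical checkerboard copula\<close>

definition empirical_cdf :: "(nat \<Rightarrow> real ^ 'd) \<Rightarrow> nat \<Rightarrow> real ^ 'd \<Rightarrow> real" where
  "empirical_cdf x n v = real (card {i. i < n \<and> (\<forall>j. x i $ j \<le> v $ j)}) / real n"

lemma empirical_cdf_margin_point:
  assumes "\<And>i j. U i $ j \<le> 1"
  shows "empirical_cdf U n (margin_point j t) = real (card {i. i < n \<and> U i $ j \<le> t}) / real n"
proof -
  have "(\<forall>k. U i $ k \<le> margin_point j t $ k) \<longleftrightarrow> U i $ j \<le> t" for i
    using assms by (auto simp: margin_point_def)
  then show ?thesis by (simp add: empirical_cdf_def)
qed

lemma empirical_cdf_eq_sum:
  "empirical_cdf U n v = 1 / real n * (\<Sum>i<n. of_bool (\<forall>j. U i $ j \<le> v $ j))"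
proof -
  have "{i. i < n \<and> (\<forall>j. U i $ j \<le> v $ j)} = {..<n} \<inter> {i. \<forall>j. U i $ j \<le> v $ j}" by auto
  then show ?thesis by (simp add: empirical_cdf_def)
qed

text \<open>If observation \<open>i\<close> is counted at \<open>a\<close>, monotonicity bounds its
  rank by the number of \<open>l\<close> with \<open>U l $ j \<le> a $ j\<close>, hence by
  \<open>n * u $ j\<close>, so all its clamped factors are 1. If some \<open>a $ j\<close> is
  negative, nothing is counted.\<close>

lemma empirical_cdf_le_checkerboard:
  fixes x U :: "nat \<Rightarrow> real ^ 'd"
  assumes n: "0 < n"
    and g: "\<And>j. mono (g j)" "\<And>i j. U i $ j = g j (x i $ j)"
    and U: "\<And>i j. 0 \<le> U i $ j" "\<And>i j. U i $ j \<le> 1"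
    and a: "\<And>j. a $ j < 0 \<or> empirical_cdf U n (margin_point j (a $ j)) \<le> u $ j"
  shows "empirical_cdf U n a \<le> checkerboard_copula x n u"
  unfolding empirical_cdf_eq_sum checkerboard_copula_def
proof (intro mult_left_mono sum_mono)
  fix i assume "i \<in> {..<n}"
  show "of_bool (\<forall>j. U i $ j \<le> a $ j)
    \<le> (\<Prod>j\<in>UNIV. min (max (real n * u $ j - real (sample_rank x n i j) + 1) 0) (1::real))"
  proof (cases "\<forall>j. U i $ j \<le> a $ j")
    case True
    have "real (sample_rank x n i j) \<le> real n * u $ j" for j
    proof -
      have "{l. l < n \<and> x l $ j \<le> x i $ j} \<subseteq> {l. l < n \<and> U l $ j \<le> a $ j}"
        using True g by (auto dest: monoD[OF g(1)] intro: order_trans)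
      then have "sample_rank x n i j \<le> card {l. l < n \<and> U l $ j \<le> a $ j}"
        unfolding sample_rank_def by (intro card_mono) auto
      also have "real \<dots> = real n * empirical_cdf U n (margin_point j (a $ j))"
        using n by (simp add: empirical_cdf_margin_point[OF U(2)])
      also have "\<dots> \<le> real n * u $ j"
        using a[of j] True U(1)[of i j] by (intro mult_left_mono) (auto dest: order_trans[of 0])
      finally show ?thesis by simp
    qed
    then have "min (max (real n * u $ j - real (sample_rank x n i j) + 1) 0) (1::real) = 1" for j
      by (smt (verit))
    then show ?thesis by simp
  qed (auto intro!: prod_nonneg)
qed auto

text \<open>If \<open>U i $ j\<close> exceeds \<open>b $ j\<close>, every \<open>l\<close> with
  \<open>U l $ j \<le> b $ j\<close> has \<open>x l $ j\<close> below \<open>x i $ j\<close>, and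
  \<open>i\<close> itself adds one more to the rank. The rank is then at least
  \<open>n * u $ j + 1\<close>, so factor \<open>j\<close> is 0. A coordinate with
  \<open>1 \<le> b $ j\<close> cannot be exceeded.\<close>

lemma checkerboard_le_empirical_cdf:
  fixes x U :: "nat \<Rightarrow> real ^ 'd"
  assumes n: "0 < n"
    and g: "\<And>j. mono (g j)" "\<And>i j. U i $ j = g j (x i $ j)"
    and U: "\<And>i j. U i $ j \<le> 1"
    and b: "\<And>j. 1 \<le> b $ j \<or> u $ j \<le> empirical_cdf U n (margin_point j (b $ j))"
  shows "checkerboard_copula x n u \<le> empirical_cdf U n b"
  unfolding empirical_cdf_eq_sum checkerboard_copula_def
proof (intro mult_left_mono sum_mono)
  fix i assume i: "i \<in> {..<n}"
  show "(\<Prod>j\<in>UNIV. min (max (real n * u $ j - real (sample_rank x n i j) + 1) 0) (1::real))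
    \<le> of_bool (\<forall>j. U i $ j \<le> b $ j)"
  proof (cases "\<forall>j. U i $ j \<le> b $ j")
    case True
    then show ?thesis by (auto intro!: prod_le_1)
  next
    case False
    then obtain j where j: "b $ j < U i $ j" by (auto simp: not_le)
    then have "u $ j \<le> empirical_cdf U n (margin_point j (b $ j))"
      using b[of j] U[of i j] by linarith
    then have "real n * u $ j \<le> real (card {l. l < n \<and> U l $ j \<le> b $ j})"
      using n by (simp add: empirical_cdf_margin_point[OF U] field_simps)
    moreover have "card {l. l < n \<and> U l $ j \<le> b $ j} < sample_rank x n i j"
      unfolding sample_rank_def
    proof (rule psubset_card_mono)
      have "x l $ j \<le> x i $ j" if "U l $ j \<le> b $ j" for l
        using that j monoD[OF g(1), of "x i $ j" "x l $ j" j] g(2) by (smt (verit))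
      moreover have "i \<in> {l. l < n \<and> x l $ j \<le> x i $ j} - {l. l < n \<and> U l $ j \<le> b $ j}"
        using i j by auto
      ultimately show "{l. l < n \<and> U l $ j \<le> b $ j} \<subset> {l. l < n \<and> x l $ j \<le> x i $ j}"
        by blast
    qed auto
    ultimately have "min (max (real n * u $ j - real (sample_rank x n i j) + 1) 0) (1::real) = 0"
      by (smt (verit) less_imp_of_nat_less of_nat_Suc Suc_leI of_nat_mono)
    then have "(\<Prod>j\<in>UNIV. min (max (real n * u $ j - real (sample_rank x n i j) + 1) 0) (1::real)) = 0"
      by (intro prod_zero) auto
    with False show ?thesis by (simp only: of_bool_def if_False order_refl)
  qed
qed auto

lemma checkerboard_uniformly_close:
  fixes x U :: "nat \<Rightarrow> real ^ 'd"
  assumes g: "\<And>j. mono (g j)" "\<And>i j. U i $ j = g j (x i $ j)"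
    and U: "\<And>i j. 0 \<le> U i $ j" "\<And>i j. U i $ j \<le> 1"
    and \<nu>: "has_uniform_margins \<nu>"
    and conv: "\<And>k :: 'd \<Rightarrow> rat. (\<lambda>n. empirical_cdf U n (\<chi> j. of_rat (k j)))
      \<longlonglongrightarrow> joint_cdf \<nu> (\<chi> j. of_rat (k j))"
    and e: "0 < e"
  shows "\<forall>\<^sub>F n in sequentially. \<forall>u\<in>unit_cube. \<bar>checkerboard_copula x n u - joint_cdf \<nu> u\<bar> \<le> e"
proof -
  let ?d = "real CARD('d)"
  \<comment> \<open>The budget is \<open>3 * ?d / N\<close> for the variation of the copula between
    the two bracketing grid points and \<open>1 / N\<close> for the empirical error.\<close>
  obtain N :: nat where "(3 * ?d + 1) / e < real N"
    using reals_Archimedean2 by blast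
  moreover have "0 < (3 * ?d + 1) / e"
    using e by (simp add: add_nonneg_pos)
  ultimately have "0 < real N" "(3 * ?d + 1) / e < real N" by linarith+
  then have N: "0 < N" "(3 * ?d + 1) / real N < e"
    using e by (auto simp: divide_less_eq mult.commute)
  \<comment> \<open>The indices -1 and \<open>N + 2\<close> accommodate the bracketing points
    \<open>a\<close> and \<open>b\<close> below. Also \<open>1 = N / N\<close> lies in
    \<open>S\<close>, which puts the margin points into the grid \<open>T\<close>.\<close>
  define S where "S = (\<lambda>i. real_of_int i / real N) ` {-1..int N + 2}"
  define T where "T = {v :: real ^ 'd. \<forall>j. v $ j \<in> S}"
  have "T \<subseteq> (\<lambda>f. \<chi> j. f j) ` (UNIV \<rightarrow>\<^sub>E S)"
  proof
    fix v assume "v \<in> T"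
    then show "v \<in> (\<lambda>f. \<chi> j. f j) ` (UNIV \<rightarrow>\<^sub>E S)"
      by (intro image_eqI[of _ _ "\<lambda>j. v $ j"]) (auto simp: T_def)
  qed
  then have "finite T"
    by (rule finite_subset) (auto simp: S_def intro!: finite_PiE)
  have margin: "margin_point j s \<in> T" if "s \<in> S" for j s
    using that N by (auto simp: T_def margin_point_def S_def intro!: image_eqI[of _ _ "int N"])
  have "(\<lambda>n. empirical_cdf U n v) \<longlonglongrightarrow> joint_cdf \<nu> v" if "v \<in> T" for v
  proof -
    have "\<forall>j. \<exists>r. v $ j = of_rat r"
    proof
      fix j
      from that obtain i where "v $ j = real_of_int i / real N" by (auto simp: T_def S_def)
      then show "\<exists>r. v $ j = of_rat r"
        by (intro exI[of _ "of_int i / of_nat N"]) (simp add: of_rat_divide)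
    qed
    then obtain k where "\<And>j. v $ j = of_rat (k j)" by metis
    then have "v = (\<chi> j. of_rat (k j))" by (simp add: vec_eq_iff)
    then show ?thesis using conv[of k] by simp
  qed
  then have "eventually (\<lambda>n. \<bar>empirical_cdf U n v - joint_cdf \<nu> v\<bar> < 1 / real N) sequentially" if "v \<in> T" for v
    using tendstoD[of _ "joint_cdf \<nu> v" sequentially "1 / real N"] that N by (auto simp: dist_real_def)
  then have "eventually (\<lambda>n. \<forall>v\<in>T. \<bar>empirical_cdf U n v - joint_cdf \<nu> v\<bar> < 1 / real N) sequentially"
    using \<open>finite T\<close> by (simp add: eventually_ball_finite)
  then show ?thesis
    using eventually_gt_at_top[of 0]
  proof eventually_elim
    case (elim n)
    show ?case
    proof
      fix u :: "real ^ 'd" assume u: "u \<in> unit_cube"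
      define k where "k j = \<lfloor>real N * u $ j\<rfloor>" for j
      \<comment> \<open>Both points lie one step outside the grid cell of \<open>u\<close>: the
        extra step \<open>1 / N\<close> absorbs the error of the marginal frequencies in
        \<open>amargin\<close> and \<open>bmargin\<close>.\<close>
      define a b :: "real ^ 'd" where "a = (\<chi> j. (k j - 1) / N)" and "b = (\<chi> j. (k j + 2) / N)"
      have k: "0 \<le> k j" "k j \<le> int N" "k j / N \<le> u $ j" "u $ j \<le> (k j + 1) / N" for j
      proof -
        have "real N * u $ j \<le> real N * 1" using u by (intro mult_left_mono) auto
        then show "0 \<le> k j" "k j \<le> int N" using u by (auto simp: k_def floor_le_iff)
        show "k j / N \<le> u $ j" "u $ j \<le> (k j + 1) / N"
          using N(1) unfolding k_def by (simp_all add: field_simps) linarith+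
      qed
      have abS: "a $ j \<in> S" "b $ j \<in> S" for j
      proof -
        show "a $ j \<in> S"
          unfolding S_def using k[of j] by (intro image_eqI[of _ _ "k j - 1"]) (auto simp: a_def)
        show "b $ j \<in> S"
          unfolding S_def using k[of j] by (intro image_eqI[of _ _ "k j + 2"]) (auto simp: b_def)
      qed
      then have abT: "a \<in> T" "b \<in> T" by (auto simp: T_def)
      have amargin: "a $ j < 0 \<or> empirical_cdf U n (margin_point j (a $ j)) \<le> u $ j" for j
      proof (cases "a $ j < 0")
        case False
        have "empirical_cdf U n (margin_point j (a $ j)) \<le> max 0 (min 1 (a $ j)) + 1 / N"
          using bspec[OF elim(1) margin[OF abS(1)], of j j] by (simp add: joint_cdf_margin_point[OF \<nu>])
        also have "\<dots> \<le> a $ j + 1 / N" using False by simp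
        also have "\<dots> = k j / N" by (simp add: a_def diff_divide_distrib)
        finally show ?thesis using k(3)[of j] by simp
      qed simp
      have bmargin: "1 \<le> b $ j \<or> u $ j \<le> empirical_cdf U n (margin_point j (b $ j))" for j
      proof (cases "1 \<le> b $ j")
        case False
        have "u $ j \<le> b $ j - 1 / N"
          using k(4)[of j] by (simp add: b_def add_divide_distrib)
        also have "\<dots> \<le> max 0 (min 1 (b $ j)) - 1 / N" using False by simp
        also have "\<dots> \<le> empirical_cdf U n (margin_point j (b $ j))"
          using bspec[OF elim(1) margin[OF abS(2)], of j j] by (simp add: joint_cdf_margin_point[OF \<nu>])
        finally show ?thesis by simp
      qed simp
      have "joint_cdf \<nu> a - 1 / N \<le> checkerboard_copula x n u"
        using empirical_cdf_le_checkerboard[OF elim(2) g U amargin] bspec[OF elim(1) abT(1)] by simp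
      moreover have "checkerboard_copula x n u \<le> joint_cdf \<nu> b + 1 / N"
        using checkerboard_le_empirical_cdf[OF elim(2) g U(2) bmargin] bspec[OF elim(1) abT(2)] by simp
      moreover have "joint_cdf \<nu> a \<le> joint_cdf \<nu> u" "joint_cdf \<nu> u \<le> joint_cdf \<nu> b"
      proof -
        have "a $ j \<le> u $ j" "u $ j \<le> b $ j" for j
          using k(3,4)[of j] N(1) by (auto simp: a_def b_def field_simps)
        then show "joint_cdf \<nu> a \<le> joint_cdf \<nu> u" "joint_cdf \<nu> u \<le> joint_cdf \<nu> b"
          using \<nu> by (auto intro!: joint_cdf_mono simp: has_uniform_margins_def)
      qed
      moreover have "joint_cdf \<nu> b - joint_cdf \<nu> a \<le> 3 * ?d / N"
      proof -
        have "b $ j - a $ j = 3 / N" for j by (simp add: a_def b_def diff_divide_distrib[symmetric])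
        then show ?thesis using joint_cdf_diff_le[OF \<nu>, of b a] by (simp add: mult.commute)
      qed
      ultimately have "\<bar>checkerboard_copula x n u - joint_cdf \<nu> u\<bar> \<le> (3 * ?d + 1) / N"
        by (simp add: add_divide_distrib abs_le_iff)
      then show "\<bar>checkerboard_copula x n u - joint_cdf \<nu> u\<bar> \<le> e" using N(2) by linarith
    qed
  qed
qed

subsection \<open>Convergence of the expected sup-distance\<close>

text \<open>A non-integrable function has Bochner integral 0, which is also at most
  \<open>c\<close>. The expectation of the supremum can thus be bounded through nonnegative
  integrals of a measurable majorant.\<close>

lemma integral_le_of_nn_integral_le:
  fixes f :: "'a \<Rightarrow> real"
  assumes "\<And>x. 0 \<le> f x" "(\<integral>\<^sup>+x. ennreal (f x) \<partial>M) \<le> ennreal c" "0 \<le> c"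
  shows "(\<integral>x. f x \<partial>M) \<le> c"
proof (cases "integrable M f")
  case True
  then show ?thesis using nn_integral_eq_integral[OF True] assms by simp
qed (simp add: not_integrable_integral_eq assms)

text \<open>This is the deterministic half: one data sequence is fixed along which the checkerboard
  copulas converge uniformly, and the only randomness left is the prior.\<close>

lemma expected_sup_norm_tendsto_0:
  fixes C :: "real ^ 'd \<Rightarrow> real"
  assumes close: "\<And>e. 0 < e \<Longrightarrow>
      \<forall>\<^sub>F n in sequentially. \<forall>u\<in>unit_cube. \<bar>checkerboard_copula x n u - C u\<bar> \<le> e"
    and lip: "\<And>v w. v \<in> unit_cube \<Longrightarrow> w \<in> unit_cube \<Longrightarrow> \<bar>C v - C w\<bar> \<le> (\<Sum>j\<in>UNIV. \<bar>v $ j - w $ j\<bar>)"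
    and C: "\<And>u. u \<in> unit_cube \<Longrightarrow> 0 \<le> C u" "\<And>u. u \<in> unit_cube \<Longrightarrow> C u \<le> 1"
  shows "(\<lambda>n. \<integral>m. sup_norm (\<lambda>u. ecbc x n m u - C u) \<partial>degree_prior n) \<longlonglongrightarrow> 0"
proof (rule tendstoI)
  let ?d = "real CARD('d)"
  define f where "f n m = sup_norm (\<lambda>u. ecbc x n m u - C u)" for n and m :: "'d \<Rightarrow> nat"
  have ne: "(0 :: real ^ 'd) \<in> unit_cube" by simp
  have bound: "\<bar>ecbc x n m u - C u\<bar> \<le> 1" if "u \<in> unit_cube" for n m u
    using ecbc_bounds[OF that, of x n m] C[OF that] by linarith
  have f0: "0 \<le> f n m" for n m
  proof -
    have "\<bar>ecbc x n m 0 - C 0\<bar> \<le> f n m"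
      unfolding f_def sup_norm_def using bound ne by (intro cSUP_upper bdd_aboveI2[where M = 1]) auto
    then show ?thesis by linarith
  qed
  have f_le: "f n m \<le> c" if "\<And>u. u \<in> unit_cube \<Longrightarrow> \<bar>ecbc x n m u - C u\<bar> \<le> c" for n m c
    unfolding f_def sup_norm_def using that ne by (intro cSUP_least) blast+
  fix \<epsilon> :: real assume "0 < \<epsilon>"
  \<comment> \<open>With this \<open>t\<close> the term \<open>?d * (t / 2)\<close> equals
    \<open>e\<close>. The checkerboard error, this term and the vanishing prior term then total less
    than \<open>3 * e\<close>, which is below \<open>\<epsilon>\<close>.\<close>
  define e t where "e = \<epsilon> / 4" and "t = \<epsilon> / (2 * ?d)"
  have e: "0 < e" and t: "0 < t" using \<open>0 < \<epsilon>\<close> by (auto simp: e_def t_def)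
  have "(\<lambda>n. ?d / (8 * t * real n powr (1/3))) \<longlonglongrightarrow> 0"
    using t by real_asymp
  then have "\<forall>\<^sub>F n in sequentially. ?d / (8 * t * real n powr (1/3)) < e"
    using e by (rule order_tendstoD(2))
  then show "\<forall>\<^sub>F n in sequentially.
      dist (\<integral>m. sup_norm (\<lambda>u. ecbc x n m u - C u) \<partial>degree_prior n) 0 < \<epsilon>"
    using close[OF e] eventually_gt_at_top[of 0]
  proof eventually_elim
    case (elim n)
    \<comment> \<open>The value 1 at 0 makes the bound \<open>fg\<close> hold for degree vectors with a zero entry as well.\<close>
    define g where "g m = (if m = 0 then 1 else t / 2 + 1 / (8 * t * real m))" for m
    have g0: "0 \<le> g m" for m using t by (simp add: g_def)
    have fg: "f n m \<le> e + (\<Sum>j\<in>UNIV. g (m j))" for m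
    proof (cases "\<exists>j. m j = 0")
      case True
      then obtain j where "m j = 0" by blast
      then have "1 \<le> (\<Sum>j\<in>UNIV. g (m j))"
        using member_le_sum[of j UNIV "\<lambda>j. g (m j)"] g0 by (simp add: g_def)
      then have "1 \<le> e + (\<Sum>j\<in>UNIV. g (m j))" using e by linarith
      then show ?thesis by (intro f_le order_trans[OF bound])
    next
      case False
      then have m0: "\<And>j. m j \<noteq> 0" by metis
      have "(\<Sum>j\<in>UNIV. g (m j)) = (\<Sum>j\<in>UNIV. t / 2 + 1 / (8 * t * real (m j)))"
        by (simp add: g_def m0)
      with False show ?thesis
        using elim(2) lip t by (auto intro!: f_le ecbc_approximation)
    qed
    define c where "c = t / 2 + 1 / (8 * t * real n powr (1/3))"
    have c: "0 \<le> c" using t by (simp add: c_def)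
    have [measurable]: "(\<lambda>m. ennreal (g (m j))) \<in> borel_measurable (degree_prior n)" for j :: 'd
    proof -
      have "(\<lambda>m. m j) \<in> degree_prior n \<rightarrow>\<^sub>M count_space UNIV"
        by (simp add: degree_prior_def)
      from measurable_compose[OF this, of "\<lambda>k. ennreal (g k)" borel] show ?thesis by simp
    qed
    interpret prob_space "degree_prior n :: ('d \<Rightarrow> nat) measure"
      by (rule prob_space_degree_prior[OF elim(3)])
    have gc: "(\<integral>\<^sup>+m. ennreal (g (m j)) \<partial>degree_prior n) \<le> ennreal c" for j :: 'd
      using nn_integral_degree_prior_inverse_le[OF elim(3), of "8 * t" "t / 2" j 1] t
      by (simp add: g_def c_def)
    have "(\<integral>\<^sup>+m. ennreal (f n m) \<partial>degree_prior n)
        \<le> (\<integral>\<^sup>+m. ennreal e + (\<Sum>j\<in>(UNIV :: 'd set). ennreal (g (m j))) \<partial>degree_prior n)"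
    proof (rule nn_integral_mono)
      fix m
      have "ennreal (f n m) \<le> ennreal (e + (\<Sum>j\<in>UNIV. g (m j)))" by (intro ennreal_leI fg)
      then show "ennreal (f n m) \<le> ennreal e + (\<Sum>j\<in>UNIV. ennreal (g (m j)))"
        using e g0 by (simp add: sum_nonneg)
    qed
    also have "\<dots> = ennreal e + (\<Sum>j\<in>(UNIV :: 'd set). \<integral>\<^sup>+m. ennreal (g (m j)) \<partial>degree_prior n)"
      by (simp add: nn_integral_add nn_integral_sum emeasure_space_1)
    also have "\<dots> \<le> ennreal e + (\<Sum>j\<in>(UNIV::'d set). ennreal c)"
      by (intro add_left_mono sum_mono gc)
    also have "\<dots> = ennreal (e + ?d * c)"
      using e c by (simp add: ennreal_mult ennreal_of_nat_eq_real_of_nat)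
    finally have "(\<integral>m. f n m \<partial>degree_prior n) \<le> e + ?d * c"
      using e c f0 by (intro integral_le_of_nn_integral_le) auto
    moreover have "?d * c = e + ?d / (8 * t * real n powr (1/3))"
      by (simp add: c_def e_def t_def distrib_left)
    moreover have "0 \<le> (\<integral>m. f n m \<partial>degree_prior n)"
      by (rule Bochner_Integration.integral_nonneg[OF f0])
    moreover have "3 * e < \<epsilon>" using \<open>0 < \<epsilon>\<close> by (simp add: e_def)
    ultimately show ?case using elim(1) by (simp add: f_def[symmetric] dist_real_def)
  qed
qed

theorem theorem1:
  fixes M :: "'w measure"
    and X :: "nat \<Rightarrow> 'w \<Rightarrow> real ^ 'd"
    and F :: "real ^ 'd \<Rightarrow> real"
    and Fm :: "'d \<Rightarrow> real \<Rightarrow> real"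
    and C :: "real ^ 'd \<Rightarrow> real"
  assumes prob: "prob_space M"
    and dim: "CARD('d) \<ge> 2"
    and indep: "prob_space.indep_vars M (\<lambda>_. borel) X UNIV"
    and ident: "\<And>i. distr M borel (X i) = distr M borel (X 0)"
    and joint: "F = joint_cdf (distr M borel (X 0))"
    and marginal: "\<And>j. Fm j = cdf (distr M borel (\<lambda>\<omega>. X 0 \<omega> $ j))"
    and abs_cont: "\<And>j. absolutely_continuous_function (Fm j)"
    and copula: "is_copula C"
    and sklar: "\<And>x. F x = C (\<chi> j. Fm j (x $ j))"
  shows "AE \<omega> in M.
    (\<lambda>n. \<integral>m. sup_norm (\<lambda>u. ecbc (\<lambda>i. X i \<omega>) n m u - C u) \<partial>degree_prior n) \<longlonglongrightarrow> 0"
proof -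
  interpret prob_space M by fact
  obtain \<mu> :: "(real ^ 'd) measure" where \<mu>: "has_uniform_margins \<mu>"
    "\<And>u. u \<in> unit_cube \<Longrightarrow> C u = joint_cdf \<mu> u"
    using is_copula_imp_uniform_margins[OF copula] by blast
  have X[measurable]: "X i \<in> borel_measurable M" for i
    using indep by (auto simp: indep_vars_def)
  define P where "P = distr M borel (X 0)"
  define \<nu> where "\<nu> = distr P borel (\<lambda>y. \<chi> j. Fm j (y $ j))"
  have P: "prob_space P" "sets P = sets borel"
    by (auto simp: P_def intro: prob_space_distr)
  have cont: "isCont (Fm j) x" for j x
    by (rule absolutely_continuous_function_imp_isCont[OF abs_cont])
  have FmP: "Fm j = cdf (distr P borel (\<lambda>y. y $ j))" for j
    unfolding P_def marginal by (subst distr_distr) (auto simp: comp_def)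
  have sklarP: "joint_cdf P x = C (\<chi> j. Fm j (x $ j))" for x
    using sklar[of x] by (simp add: joint P_def)
  have \<nu>: "has_uniform_margins \<nu>" "\<And>u. u \<in> unit_cube \<Longrightarrow> joint_cdf \<nu> u = C u"
    unfolding \<nu>_def using has_uniform_margins_transform[OF P FmP cont \<mu> sklarP]
      joint_cdf_transform[OF P FmP cont \<mu> sklarP] by auto
  have rd: "real_distribution (distr M borel (\<lambda>\<omega>. X 0 \<omega> $ j))" for j
    by (rule real_distribution_distr) measurable
  have Fm: "mono (Fm j)" "0 \<le> Fm j t" "Fm j t \<le> 1" for j t
  proof -
    interpret R: real_distribution "distr M borel (\<lambda>\<omega>. X 0 \<omega> $ j)" by (rule rd)
    show "mono (Fm j)" "0 \<le> Fm j t" "Fm j t \<le> 1"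
      unfolding marginal
      by (auto intro!: monoI R.cdf_nondecreasing R.cdf_nonneg R.cdf_bounded_prob)
  qed
  have [measurable]: "Fm j \<in> borel_measurable borel" for j
    by (intro borel_measurable_mono Fm)
  have phi: "(\<lambda>y. \<chi> j. Fm j (y $ j)) \<in> P \<rightarrow>\<^sub>M borel"
    using P(2) by (intro borel_measurable_vec_lambda) (auto simp: P_def)
  have joint_nu: "joint_cdf \<nu> v = measure P {y. \<forall>j. Fm j (y $ j) \<le> v $ j}" for v
    unfolding joint_cdf_def \<nu>_def using sets_eq_imp_space_eq[OF P(2)]
    by (subst measure_distr[OF phi]) (auto simp: vimage_def)
  define U where "U \<omega> i = (\<chi> j. Fm j (X i \<omega> $ j))" for \<omega> i
  \<comment> \<open>The event that the transformed observation lies below \<open>v\<close> is one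
    fixed Borel event for \<open>X i\<close>, so the frequency theorem applies to the original
    sample.\<close>
  have "AE \<omega> in M. (\<lambda>n. empirical_cdf (U \<omega>) n v) \<longlonglongrightarrow> joint_cdf \<nu> v" for v
    using frequency_tendsto_prob[OF indep ident, of "{y. \<forall>j. Fm j (y $ j) \<le> v $ j}"]
    by (simp add: joint_nu P_def empirical_cdf_def U_def)
  \<comment> \<open>Rational points form a countable set, so one null set serves them all; the grid
    of \<open>checkerboard_uniformly_close\<close> consists of such points.\<close>
  then have "AE \<omega> in M. \<forall>k :: 'd \<Rightarrow> rat.
      (\<lambda>n. empirical_cdf (U \<omega>) n (\<chi> j. of_rat (k j))) \<longlonglongrightarrow> joint_cdf \<nu> (\<chi> j. of_rat (k j))"
    by (simp add: AE_all_countable)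
  then show ?thesis
  proof eventually_elim
    case (elim \<omega>)
    have "\<forall>\<^sub>F n in sequentially. \<forall>u\<in>unit_cube.
        \<bar>checkerboard_copula (\<lambda>i. X i \<omega>) n u - joint_cdf \<nu> u\<bar> \<le> e" if "0 < e" for e
      using elim that Fm
      by (intro checkerboard_uniformly_close[where U = "U \<omega>" and g = Fm] \<nu>) (auto simp: U_def)
    then have "\<forall>\<^sub>F n in sequentially. \<forall>u\<in>unit_cube.
        \<bar>checkerboard_copula (\<lambda>i. X i \<omega>) n u - C u\<bar> \<le> e" if "0 < e" for e
      using that \<nu>(2) by (auto elim!: eventually_mono)
    moreover have "prob_space \<mu>" using \<mu>(1) by (simp add: has_uniform_margins_def)
    then have "0 \<le> C u" "C u \<le> 1" if "u \<in> unit_cube" for u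
      using that by (auto simp: \<mu>(2) joint_cdf_def prob_space.prob_le_1)
    moreover have "\<bar>C v - C w\<bar> \<le> (\<Sum>j\<in>UNIV. \<bar>v $ j - w $ j\<bar>)"
      if "v \<in> unit_cube" "w \<in> unit_cube" for v w
      using joint_cdf_lipschitz[OF \<mu>(1), of v w] that by (simp only: \<mu>(2))
    ultimately show ?case
      by (intro expected_sup_norm_tendsto_0) auto
  qed
qed

end
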